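(* Let $\mathcal{C}\subseteq 2^{[n]}$ be a code. Given a realization $\mathcal{U} = \{U_1, \ldots, U_n\}$ of $\mathcal{C}$ by boxes in $\mathbb{R}^d$, there exists a realization $\mathcal{V} = \{V_1,\ldots, V_n\}$ of $\mathcal{C}$ by boxes in $\mathbb{R}^d$ with the following properties: (i) each (nonempty) $V_i$ has corners with integer coordinates between $1$ and $2n$; that is, each nonempty $V_i$ is the Cartesian product of closed intervals with integer endpoints between $1$ and $2n$; and (ii) the interiors of the $V_i$ also comprise a realization of $\mathcal{C}$. Moreover, if $\mathcal{C}$ has a realization by interiors of boxes in $\mathbb{R}^d$, then it has a realization by boxes in $\mathbb{R}^d$.
   Context: Write $[n]=\{1,\ldots,n\}$. A code is a set $\mathcal{C}\subseteq 2^{[n]}$. For an ordered (indexed) collection $\mathcal{U} = \{U_1, \ldots, U_n\}$ of sets in $\mathbb{R}^d$, where $d\ge 1$, its code is $$\operatorname{code}(\mathcal{U}) = \{\sigma\subseteq [n] \mid \text{there exists } p\in \mathbb{R}^d \text{ such that for all } i\in[n],\ p\in U_i \text{ if and only if } i\in\sigma\},$$ and $\mathcal{U}$ is called a realization of $\operatorname{code}(\mathcal{U})$. An axis-parallel box (box for short) in $\mathbb{R}^d$ is either the empty set or a product $[a_1,b_1]\times\cdots\times[a_d,b_d]$ of nonempty closed intervals (degenerate intervals $a_i=b_i$ allowed). Interiors are taken in $\mathbb{R}^d$. *)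

theory Defs
  imports "HOL-Analysis.Analysis"
begin

text \<open>
  An indexed collection \<open>U 1, \<dots>, U n\<close> is a function on \<^typ>\<open>nat\<close>; only its values on
  \<open>{1..n}\<close> are relevant. For \<open>n = 0\<close> the code is \<open>{{}}\<close>.
\<close>

definition code_of :: "nat \<Rightarrow> (nat \<Rightarrow> (real ^ 'd) set) \<Rightarrow> nat set set" where
  "code_of n U = {\<sigma>. \<sigma> \<subseteq> {1..n} \<and> (\<exists>p. \<forall>i\<in>{1..n}. p \<in> U i \<longleftrightarrow> i \<in> \<sigma>)}"

definition realizes :: "nat \<Rightarrow> (nat \<Rightarrow> (real ^ 'd) set) \<Rightarrow> nat set set \<Rightarrow> bool" where
  "realizes n U C \<longleftrightarrow> code_of n U = C"

text \<open>
  Boxes here are closed and may be degenerate; they are instances of the library's \<^const>\<open>cbox\<close>,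
  not of the open \<^const>\<open>box\<close>. By \<open>mem_box_cart\<close>, \<open>cbox a b\<close> is the product of the intervals
  \<open>{a $ k..b $ k}\<close>.
\<close>

definition axis_box :: "(real ^ 'd) set \<Rightarrow> bool" where
  "axis_box B \<longleftrightarrow> B = {} \<or> (\<exists>a b. (\<forall>k. a $ k \<le> b $ k) \<and> B = cbox a b)"

definition integer_box :: "nat \<Rightarrow> (real ^ 'd) set \<Rightarrow> bool" where
  "integer_box m B \<longleftrightarrow>
    (\<exists>a b. (\<forall>k. a $ k \<in> \<int> \<and> b $ k \<in> \<int> \<and> 1 \<le> a $ k \<and> a $ k \<le> b $ k \<and> b $ k \<le> real m)
      \<and> B = cbox a b)"

end

theory Submission
  imports Defs
begin

text \<open>
  A point lies in a box iff each coordinate lies in the corresponding interval, so everything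
  reduces to one coordinate at a time. Which sets of intervals can be cut out by a point of the line
  depends only on the relative order of the endpoints. In it, a tie between a left and a right
  endpoint counts as left before right for closed intervals and as right before left for open ones.
  Replacing endpoints by their ranks, with ties of closed intervals broken in this way, separates
  left from right endpoints, after which closed and open intervals cut out the same sets.
  Conversely, shrinking open intervals slightly gives closed intervals with the same sets.
\<close>

section \<open>One coordinate: intervals on the line\<close>

text \<open>The midpoint between the largest element of \<open>P \<union> Q\<close> and the smallest
  of \<open>S \<union> T\<close> works. This supplies the points of the line that sit in a
  prescribed position among finitely many endpoints; equality is tolerated only between the two weak
  bounds \<open>P\<close> and \<open>T\<close>.\<close>

lemma exists_between_finite:
  fixes P Q S T :: "real set"
  assumes fin: "finite P" "finite Q" "finite S" "finite T"
    and "\<And>p s. p \<in> P \<Longrightarrow> s \<in> S \<Longrightarrow> p < s" "\<And>p t. p \<in> P \<Longrightarrow> t \<in> T \<Longrightarrow> p \<le> t"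
    and "\<And>q s. q \<in> Q \<Longrightarrow> s \<in> S \<Longrightarrow> q < s" "\<And>q t. q \<in> Q \<Longrightarrow> t \<in> T \<Longrightarrow> q < t"
  obtains x where "\<forall>p\<in>P. p \<le> x" "\<forall>q\<in>Q. q < x" "\<forall>s\<in>S. x < s" "\<forall>t\<in>T. x \<le> t"
proof (cases "P \<union> Q = {} \<or> S \<union> T = {}")
  case True
  then show ?thesis
  proof
    assume *: "P \<union> Q = {}"
    obtain m where m: "\<forall>u\<in>S \<union> T. m < u"
      using bdd_below_finite[of "S \<union> T"] fin gt_ex lt_ex
      by (metis bdd_below.E finite_UnI order_less_le_trans)
    from * m show ?thesis by (intro that[of m]) (auto intro: less_imp_le)
  next
    assume *: "S \<union> T = {}"
    obtain M where M: "\<forall>l\<in>P \<union> Q. l < M"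
      using bdd_above_finite[of "P \<union> Q"] fin gt_ex
      by (metis bdd_above.E finite_UnI order_le_less_trans)
    from * M show ?thesis by (intro that[of M]) (auto intro: less_imp_le)
  qed
next
  case False
  define M m where "M = Max (P \<union> Q)" and "m = Min (S \<union> T)"
  have M: "M \<in> P \<union> Q" "\<And>l. l \<in> P \<union> Q \<Longrightarrow> l \<le> M"
    unfolding M_def using False fin by (auto intro: Max_in simp del: Un_iff)
  have m: "m \<in> S \<union> T" "\<And>u. u \<in> S \<union> T \<Longrightarrow> m \<le> u"
    unfolding m_def using False fin by (auto intro: Min_in simp del: Un_iff)
  have "M \<le> m" using M(1) m(1) assms(5-) by (auto intro: less_imp_le)
  moreover have "q < m" if "q \<in> Q" for q using that m(1) assms(7,8) by blast
  moreover have "M < s" if "s \<in> S" for s using that M(1) assms(5,7) by blast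
  \<comment> \<open>\<open>M = m\<close> may occur. The strict bounds survive because
    \<open>q \<le> M\<close> and \<open>q < m\<close> average to \<open>q < (M + m) / 2\<close>, and
    symmetrically for \<open>s\<close>.\<close>
  ultimately have
    "\<And>p. p \<in> P \<Longrightarrow> p \<le> (M + m) / 2" "\<And>q. q \<in> Q \<Longrightarrow> q < (M + m) / 2"
    "\<And>s. s \<in> S \<Longrightarrow> (M + m) / 2 < s" "\<And>t. t \<in> T \<Longrightarrow> (M + m) / 2 \<le> t"
    using M(2) m(2) by (simp_all add: field_simps) (smt (verit))+
  then show ?thesis using that by blast
qed

text \<open>A point is transferred by asking for a new point in the corresponding position among the
  other endpoints; the order hypotheses make these demands consistent. In \<open>ab\<close>,
  \<open>\<le>\<close> is matched with \<open><\<close> because closed intervals that merely touch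
  share a point, while open ones do not.\<close>

lemma closed_traces_eq_open_traces:
  fixes a b a' b' :: "'i \<Rightarrow> real"
  assumes fin: "finite N"
    and aa: "\<And>i j. i \<in> N \<Longrightarrow> j \<in> N \<Longrightarrow> a i < a j \<longleftrightarrow> a' i < a' j"
    and bb: "\<And>i j. i \<in> N \<Longrightarrow> j \<in> N \<Longrightarrow> b i < b j \<longleftrightarrow> b' i < b' j"
    and ab: "\<And>i j. i \<in> N \<Longrightarrow> j \<in> N \<Longrightarrow> a i \<le> b j \<longleftrightarrow> a' i < b' j"
  shows "range (\<lambda>x. {i \<in> N. x \<in> {a i..b i}}) = range (\<lambda>y. {i \<in> N. y \<in> {a' i<..<b' i}})"
proof -
  have ba: "b' i \<le> a' j \<longleftrightarrow> b i < a j" if "i \<in> N" "j \<in> N" for i j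
    using ab[of j i] that by (auto simp: not_less[symmetric])
  have "\<exists>y. {i \<in> N. x \<in> {a i..b i}} = {i \<in> N. y \<in> {a' i<..<b' i}}" for x
  proof -
    \<comment> \<open>A left endpoint at or below \<open>x\<close> must go strictly below
      \<open>y\<close>, a right endpoint at or above \<open>x\<close> strictly above it; the
      remaining endpoints need only weak bounds. Comparing two endpoints through \<open>x\<close>
      yields each premise of \<open>exists_between_finite\<close>.\<close>
    obtain y where
      "\<forall>p\<in>b' ` {i \<in> N. b i < x}. p \<le> y" "\<forall>q\<in>a' ` {i \<in> N. a i \<le> x}. q < y"
      "\<forall>s\<in>b' ` {i \<in> N. x \<le> b i}. y < s" "\<forall>t\<in>a' ` {i \<in> N. x < a i}. y \<le> t"
      by (rule exists_between_finite[of "b' ` {i \<in> N. b i < x}" "a' ` {i \<in> N. a i \<le> x}"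
            "b' ` {i \<in> N. x \<le> b i}" "a' ` {i \<in> N. x < a i}"])
        (use fin in \<open>auto simp: aa[symmetric] bb[symmetric] ab[symmetric] ba\<close>)
    then have "a i \<le> x \<longleftrightarrow> a' i < y" "x \<le> b i \<longleftrightarrow> y < b' i" if "i \<in> N" for i
      using that by (auto simp: not_le[symmetric])
    then show ?thesis by auto
  qed
  moreover have "\<exists>x. {i \<in> N. y \<in> {a' i<..<b' i}} = {i \<in> N. x \<in> {a i..b i}}" for y
  proof -
    \<comment> \<open>Weak and strict bounds trade places, since membership is now to be decided by
      closed intervals.\<close>
    obtain x where
      "\<forall>p\<in>a ` {i \<in> N. a' i < y}. p \<le> x" "\<forall>q\<in>b ` {i \<in> N. b' i \<le> y}. q < x"
      "\<forall>s\<in>a ` {i \<in> N. y \<le> a' i}. x < s" "\<forall>t\<in>b ` {i \<in> N. y < b' i}. x \<le> t"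
      by (rule exists_between_finite[of "a ` {i \<in> N. a' i < y}" "b ` {i \<in> N. b' i \<le> y}"
            "a ` {i \<in> N. y \<le> a' i}" "b ` {i \<in> N. y < b' i}"])
        (use fin in \<open>auto simp: aa bb ab ba[symmetric]\<close>)
    then have "a' i < y \<longleftrightarrow> a i \<le> x" "y < b' i \<longleftrightarrow> x \<le> b i" if "i \<in> N" for i
      using that by (auto simp: not_le[symmetric])
    then show ?thesis by auto
  qed
  ultimately show ?thesis by blast
qed

text \<open>The rank of an endpoint is one plus the number of endpoints before it, with left
  endpoints placed before right endpoints of the same value. Ties between endpoints of the same kind
  are kept, while a left and a right rank never agree.\<close>

lemma endpoint_ranks:
  fixes a b :: "'i \<Rightarrow> real"
  assumes fin: "finite N"
  obtains a' b' :: "'i \<Rightarrow> real" where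
    "\<And>i j. i \<in> N \<Longrightarrow> j \<in> N \<Longrightarrow> a i < a j \<longleftrightarrow> a' i < a' j"
    "\<And>i j. i \<in> N \<Longrightarrow> j \<in> N \<Longrightarrow> b i < b j \<longleftrightarrow> b' i < b' j"
    "\<And>i j. i \<in> N \<Longrightarrow> j \<in> N \<Longrightarrow> a i \<le> b j \<longleftrightarrow> a' i < b' j"
    "\<And>i j. i \<in> N \<Longrightarrow> j \<in> N \<Longrightarrow> a' i \<noteq> b' j"
    "\<And>i. i \<in> N \<Longrightarrow> a' i \<in> \<int> \<and> 1 \<le> a' i \<and> b' i \<in> \<int> \<and> b' i \<le> real (2 * card N)"
proof -
  define La where "La x = card {j \<in> N. a j < x}" for x
  define Ka where "Ka x = card {j \<in> N. a j \<le> x}" for x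
  define Lb where "Lb x = card {j \<in> N. b j < x}" for x
  note defs = La_def Ka_def Lb_def
  have mono: "La x \<le> La y" "Ka x \<le> Ka y" "Lb x \<le> Lb y" "La x \<le> Ka y" if "x \<le> y" for x y
    using that fin unfolding defs by (auto intro!: card_mono)
  have KL: "Ka x \<le> La y" if "x < y" for x y
    using that fin unfolding defs by (auto intro!: card_mono)
  \<comment> \<open>In this and the next two facts the index \<open>i\<close> itself makes the
    inclusion of the counted sets proper: it is counted on the right but not on the left.\<close>
  have strict_a: "La (a i) < La y" if "i \<in> N" "a i < y" for i y
    using that fin unfolding defs by (intro psubset_card_mono) auto
  have strict_K: "La (a i) < Ka y" if "i \<in> N" "a i \<le> y" for i y
    using that fin unfolding defs by (intro psubset_card_mono) auto
  have strict_b: "Lb (b i) < Lb y" if "i \<in> N" "b i < y" for i y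
    using that fin unfolding defs by (intro psubset_card_mono) auto
  \<comment> \<open>The tie rule is in the choice of counts: \<open>B\<close> uses
    \<open>Ka\<close>, which includes left endpoints equal to \<open>b i\<close>, whereas
    \<open>A\<close> uses \<open>Lb\<close>, which omits right endpoints equal to
    \<open>a i\<close>. The summand 1 makes ranks start at 1.\<close>
  define A where "A i = La (a i) + Lb (a i) + 1" for i
  define B where "B i = Ka (b i) + Lb (b i) + 1" for i
  have AA: "a i < a j \<longleftrightarrow> A i < A j" if "i \<in> N" "j \<in> N" for i j
    using that strict_a[of i "a j"] mono[of "a i" "a j"] mono[of "a j" "a i"]
    unfolding A_def by (cases "a i < a j") auto
  have BB: "b i < b j \<longleftrightarrow> B i < B j" if "i \<in> N" "j \<in> N" for i j
    using that strict_b[of i "b j"] mono[of "b i" "b j"] mono[of "b j" "b i"]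
    unfolding B_def by (cases "b i < b j") auto
  have AB: "A i < B j" if "i \<in> N" "a i \<le> b j" for i j
    using that strict_K[of i "b j"] mono[of "a i" "b j"] unfolding A_def B_def by auto
  have BA: "B j < A i" if "j \<in> N" "b j < a i" for i j
    using that strict_b[of j "a i"] KL[of "b j" "a i"] unfolding A_def B_def by auto
  have bound: "B i \<le> 2 * card N" if "i \<in> N" for i
  proof -
    have "Ka (b i) \<le> card N" unfolding defs using fin by (auto intro!: card_mono)
    \<comment> \<open>The count omits \<open>i\<close> itself, which compensates for the summand 1
      in \<open>B\<close>.\<close>
    moreover have "Lb (b i) < card N"
      unfolding defs using fin that by (intro psubset_card_mono) auto
    ultimately show ?thesis unfolding B_def by simp
  qed
  show ?thesis
  proof (rule that[of "\<lambda>i. real (A i)" "\<lambda>i. real (B i)"])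
    fix i j assume "i \<in> N" "j \<in> N"
    then show "a i \<le> b j \<longleftrightarrow> real (A i) < real (B j)" "real (A i) \<noteq> real (B j)"
      using AB[of i j] BA[of j i] by (cases "a i \<le> b j"; simp)+
  next
    fix i assume "i \<in> N"
    then show "real (A i) \<in> \<int> \<and> 1 \<le> real (A i) \<and> real (B i) \<in> \<int> \<and> real (B i) \<le> real (2 * card N)"
      using bound[of i] by (simp add: A_def del: of_nat_mult)
  qed (use AA BB in auto)
qed

text \<open>Each of the finitely many strict inequalities survives for all small
  \<open>e > 0\<close>, and a failing one stays false because \<open>e\<close> only widens the gap.
  A common shift leaves the order among the \<open>a i\<close> and among the \<open>b i\<close>
  unchanged, so only these mixed comparisons need care.\<close>

lemma exists_shrink:
  fixes a b :: "'i \<Rightarrow> real"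
  assumes "finite N"
  obtains e where "\<And>i j. i \<in> N \<Longrightarrow> j \<in> N \<Longrightarrow> a i + e \<le> b j - e \<longleftrightarrow> a i < b j"
proof -
  have "eventually (\<lambda>e. a i < b j \<longrightarrow> a i + e < b j - e) (at_right 0)" for i j
  proof (cases "a i < b j")
    case True
    then show ?thesis
      by (auto simp: eventually_at_right_field intro!: exI[of _ "(b j - a i) / 2"])
  qed auto
  then have "eventually (\<lambda>e. \<forall>i\<in>N. \<forall>j\<in>N. a i < b j \<longrightarrow> a i + e < b j - e) (at_right 0)"
    using assms by (intro eventually_ball_finite ballI) auto
  then have "eventually (\<lambda>e. 0 < e \<and> (\<forall>i\<in>N. \<forall>j\<in>N. a i < b j \<longrightarrow> a i + e < b j - e)) (at_right 0)"
    by (intro eventually_conj eventually_at_right_less)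
  then obtain e where e: "0 < e" "\<forall>i\<in>N. \<forall>j\<in>N. a i < b j \<longrightarrow> a i + e < b j - e"
    using eventually_happens'[OF trivial_limit_at_right_real] by blast
  show ?thesis
  proof (rule that[of e])
    fix i j assume "i \<in> N" "j \<in> N"
    then show "a i + e \<le> b j - e \<longleftrightarrow> a i < b j" using e by force
  qed
qed

section \<open>From single coordinates to codes\<close>

text \<open>Membership is a conjunction over coordinates, so a point with the same trace can be
  chosen in each coordinate independently and the choices assembled into one vector. The condition
  \<open>i \<in> N\<close> accommodates empty sets, which have no endpoints.\<close>

lemma code_of_subset_coordinatewise:
  fixes U V :: "nat \<Rightarrow> (real ^ 'd) set"
  assumes U: "\<And>i p. i \<in> {1..n} \<Longrightarrow> p \<in> U i \<longleftrightarrow> i \<in> N \<and> (\<forall>k. p $ k \<in> I k i)"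
    and V: "\<And>i p. i \<in> {1..n} \<Longrightarrow> p \<in> V i \<longleftrightarrow> i \<in> N \<and> (\<forall>k. p $ k \<in> J k i)"
    and tr: "\<And>k. range (\<lambda>x. {i \<in> N. x \<in> I k i}) \<subseteq> range (\<lambda>x. {i \<in> N. x \<in> J k i})"
  shows "code_of n U \<subseteq> code_of n V"
proof
  fix s assume "s \<in> code_of n U"
  then obtain p where s: "s \<subseteq> {1..n}" and p: "\<forall>i\<in>{1..n}. p \<in> U i \<longleftrightarrow> i \<in> s"
    unfolding code_of_def by auto
  have "\<forall>k. \<exists>y. {i \<in> N. p $ k \<in> I k i} = {i \<in> N. y \<in> J k i}"
    using tr by blast
  then obtain y where y: "\<And>k. {i \<in> N. p $ k \<in> I k i} = {i \<in> N. y k \<in> J k i}"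
    by metis
  have "(\<chi> k. y k) \<in> V i \<longleftrightarrow> p \<in> U i" if "i \<in> {1..n}" for i
    unfolding U[OF that] V[OF that] using y by auto
  with p s show "s \<in> code_of n V"
    unfolding code_of_def by blast
qed

lemma code_of_eq_coordinatewise:
  fixes U V :: "nat \<Rightarrow> (real ^ 'd) set"
  assumes "\<And>i p. i \<in> {1..n} \<Longrightarrow> p \<in> U i \<longleftrightarrow> i \<in> N \<and> (\<forall>k. p $ k \<in> I k i)"
    and "\<And>i p. i \<in> {1..n} \<Longrightarrow> p \<in> V i \<longleftrightarrow> i \<in> N \<and> (\<forall>k. p $ k \<in> J k i)"
    and "\<And>k. range (\<lambda>x. {i \<in> N. x \<in> I k i}) = range (\<lambda>x. {i \<in> N. x \<in> J k i})"
  shows "code_of n U = code_of n V"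
  using assms code_of_subset_coordinatewise[of n U N I V J]
    code_of_subset_coordinatewise[of n V N J U I] by blast

section \<open>The two constructions of boxes\<close>

lemma integer_realization:
  fixes U :: "nat \<Rightarrow> (real ^ 'd) set"
  assumes "\<forall>i\<in>{1..n}. axis_box (U i)"
  obtains V :: "nat \<Rightarrow> (real ^ 'd) set" where
    "\<And>i. V i = {} \<or> integer_box (2 * n) (V i)"
    "code_of n V = code_of n U" "code_of n (\<lambda>i. interior (V i)) = code_of n U"
proof -
  \<comment> \<open>Only nonempty boxes are ranked; the others remain empty in
    \<open>V\<close>.\<close>
  define N where "N = {i \<in> {1..n}. U i \<noteq> {}}"
  have N: "finite N" "N \<subseteq> {1..n}" unfolding N_def by auto
  then have "card N \<le> n" using card_mono[of "{1..n}" N] by simp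
  have "\<forall>i\<in>N. \<exists>a b. (\<forall>k. a $ k \<le> b $ k) \<and> U i = cbox a b"
    using assms unfolding N_def axis_box_def by auto
  then obtain a b where ab: "\<And>i k. i \<in> N \<Longrightarrow> a i $ k \<le> b i $ k"
    and U: "\<And>i. i \<in> N \<Longrightarrow> U i = cbox (a i) (b i)"
    by metis
  have "\<forall>k. \<exists>a' b' :: nat \<Rightarrow> real.
      (\<forall>i\<in>N. \<forall>j\<in>N. (a i $ k < a j $ k \<longleftrightarrow> a' i < a' j) \<and> (b i $ k < b j $ k \<longleftrightarrow> b' i < b' j) \<and>
        (a i $ k \<le> b j $ k \<longleftrightarrow> a' i < b' j) \<and> a' i \<noteq> b' j) \<and>
      (\<forall>i\<in>N. a' i \<in> \<int> \<and> 1 \<le> a' i \<and> b' i \<in> \<int> \<and> b' i \<le> real (2 * card N))"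
  proof
    fix k
    show "\<exists>a' b' :: nat \<Rightarrow> real.
      (\<forall>i\<in>N. \<forall>j\<in>N. (a i $ k < a j $ k \<longleftrightarrow> a' i < a' j) \<and> (b i $ k < b j $ k \<longleftrightarrow> b' i < b' j) \<and>
        (a i $ k \<le> b j $ k \<longleftrightarrow> a' i < b' j) \<and> a' i \<noteq> b' j) \<and>
      (\<forall>i\<in>N. a' i \<in> \<int> \<and> 1 \<le> a' i \<and> b' i \<in> \<int> \<and> b' i \<le> real (2 * card N))"
      by (rule endpoint_ranks[OF N(1), of "\<lambda>i. a i $ k" "\<lambda>i. b i $ k"]) metis
  qed
  then obtain a' b' :: "'d \<Rightarrow> nat \<Rightarrow> real" where
    rank: "\<And>k i j. i \<in> N \<Longrightarrow> j \<in> N \<Longrightarrow> (a i $ k < a j $ k \<longleftrightarrow> a' k i < a' k j) \<and>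
        (b i $ k < b j $ k \<longleftrightarrow> b' k i < b' k j) \<and>
        (a i $ k \<le> b j $ k \<longleftrightarrow> a' k i < b' k j) \<and> a' k i \<noteq> b' k j"
    and int: "\<And>k i. i \<in> N \<Longrightarrow>
        a' k i \<in> \<int> \<and> 1 \<le> a' k i \<and> b' k i \<in> \<int> \<and> b' k i \<le> real (2 * card N)"
    by metis
  define V :: "nat \<Rightarrow> (real ^ 'd) set"
    where "V i = (if i \<in> N then cbox (\<chi> k. a' k i) (\<chi> k. b' k i) else {})" for i
  have U_mem: "p \<in> U i \<longleftrightarrow> i \<in> N \<and> (\<forall>k. p $ k \<in> {a i $ k..b i $ k})" if "i \<in> {1..n}" for i p
    using U[of i] that by (cases "i \<in> N") (auto simp: N_def mem_box_cart)
  have V_mem: "p \<in> V i \<longleftrightarrow> i \<in> N \<and> (\<forall>k. p $ k \<in> {a' k i..b' k i})" for i p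
    by (auto simp: V_def mem_box_cart)
  have int_mem: "p \<in> interior (V i) \<longleftrightarrow> i \<in> N \<and> (\<forall>k. p $ k \<in> {a' k i<..<b' k i})" for i p
    by (auto simp: V_def mem_box_cart interior_cbox)
  \<comment> \<open>The open rank intervals are the common term of comparison, here with the
    original closed intervals.\<close>
  have 1: "code_of n U = code_of n (\<lambda>i. interior (V i))"
    by (rule code_of_eq_coordinatewise[OF U_mem int_mem];
        (assumption | (rule closed_traces_eq_open_traces[OF N(1)]; use rank in blast)))
  \<comment> \<open>For the closed rank intervals, \<open>\<le>\<close> and \<open><\<close> agree
    between left and right ranks, because these are never equal.\<close>
  have 2: "code_of n V = code_of n (\<lambda>i. interior (V i))"
    by (rule code_of_eq_coordinatewise[OF V_mem int_mem];
        (assumption | (rule closed_traces_eq_open_traces[OF N(1)]; use rank in \<open>auto simp: less_le\<close>)))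
  have "integer_box (2 * n) (V i)" if "i \<in> N" for i
  proof -
    have "a' k i \<le> b' k i" for k using rank[of i i k] ab[of i k] that by auto
    moreover have "b' k i \<le> real (2 * n)" for k
      using int[OF that, of k] \<open>card N \<le> n\<close> by simp
    ultimately show ?thesis
      unfolding integer_box_def using int[OF that] that
      by (intro exI[of _ "\<chi> k. a' k i"] exI[of _ "\<chi> k. b' k i"]) (simp add: V_def)
  qed
  then have "V i = {} \<or> integer_box (2 * n) (V i)" for i
    by (cases "i \<in> N") (auto simp: V_def)
  with 1 2 that show ?thesis by auto
qed

lemma closed_realization_of_interiors:
  fixes W :: "nat \<Rightarrow> (real ^ 'd) set"
  assumes "\<forall>i\<in>{1..n}. axis_box (W i)"
  obtains V :: "nat \<Rightarrow> (real ^ 'd) set" where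
    "\<And>i. axis_box (V i)" "code_of n V = code_of n (\<lambda>i. interior (W i))"
proof -
  \<comment> \<open>A degenerate box has empty interior, so it is left out and becomes the empty set
    in \<open>V\<close>.\<close>
  define N where "N = {i \<in> {1..n}. interior (W i) \<noteq> {}}"
  have N: "finite N" unfolding N_def by auto
  have "\<forall>i\<in>N. \<exists>a b. W i = cbox a b"
    using assms unfolding N_def axis_box_def by fastforce
  then obtain a b where W: "\<And>i. i \<in> N \<Longrightarrow> W i = cbox (a i) (b i)"
    by metis
  have ab: "a i $ k < b i $ k" if "i \<in> N" for i k
  proof -
    have "box (a i) (b i) \<noteq> {}"
      using that W[OF that] by (simp add: N_def interior_cbox)
    then show ?thesis by (auto simp: mem_box_cart ex_in_conv[symmetric] intro: less_trans)
  qed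
  \<comment> \<open>The amount of shrinking may differ between coordinates, but within one
    coordinate it is the same for all boxes.\<close>
  have "\<forall>k. \<exists>e. \<forall>i\<in>N. \<forall>j\<in>N. a i $ k + e \<le> b j $ k - e \<longleftrightarrow> a i $ k < b j $ k"
  proof
    fix k
    show "\<exists>e. \<forall>i\<in>N. \<forall>j\<in>N. a i $ k + e \<le> b j $ k - e \<longleftrightarrow> a i $ k < b j $ k"
      by (rule exists_shrink[OF N, of "\<lambda>i. a i $ k" "\<lambda>i. b i $ k"]) metis
  qed
  then obtain e where
    e: "\<And>k i j. i \<in> N \<Longrightarrow> j \<in> N \<Longrightarrow> a i $ k + e k \<le> b j $ k - e k \<longleftrightarrow> a i $ k < b j $ k"
    by metis
  define V :: "nat \<Rightarrow> (real ^ 'd) set" where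
    "V i = (if i \<in> N then cbox (\<chi> k. a i $ k + e k) (\<chi> k. b i $ k - e k) else {})" for i
  have V_mem: "p \<in> V i \<longleftrightarrow> i \<in> N \<and> (\<forall>k. p $ k \<in> {a i $ k + e k..b i $ k - e k})" for i p
    by (auto simp: V_def mem_box_cart)
  have W_mem: "p \<in> interior (W i) \<longleftrightarrow> i \<in> N \<and> (\<forall>k. p $ k \<in> {a i $ k<..<b i $ k})"
    if "i \<in> {1..n}" for i p
    using W[of i] that by (cases "i \<in> N") (auto simp: N_def mem_box_cart interior_cbox)
  \<comment> \<open>The shrunken intervals play the closed side of
    \<open>closed_traces_eq_open_traces\<close>, the original open ones the other side.\<close>
  have "code_of n V = code_of n (\<lambda>i. interior (W i))"
    by (rule code_of_eq_coordinatewise[OF V_mem W_mem];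
        (assumption | (rule closed_traces_eq_open_traces[OF N]; use e in simp)))
  moreover have "axis_box (V i)" for i
  proof (cases "i \<in> N")
    case True
    then have "(\<chi> k. a i $ k + e k) $ k \<le> (\<chi> k. b i $ k - e k) $ k" for k
      using e ab by simp
    with True show ?thesis unfolding axis_box_def V_def if_P[OF True] by blast
  qed (simp add: V_def axis_box_def)
  ultimately show ?thesis using that by blast
qed

lemma integer_box_imp_axis_box: "integer_box m B \<Longrightarrow> axis_box B"
  unfolding integer_box_def axis_box_def by blast

theorem theorem16:
  fixes n :: nat and C :: "nat set set"
  assumes "C \<subseteq> Pow {1..n}"
  shows "(\<forall>U :: nat \<Rightarrow> (real ^ 'd) set.
            (\<forall>i\<in>{1..n}. axis_box (U i)) \<and> realizes n U C \<longrightarrow>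
            (\<exists>V :: nat \<Rightarrow> (real ^ 'd) set.
               (\<forall>i\<in>{1..n}. axis_box (V i)) \<and> realizes n V C \<and>
               (\<forall>i\<in>{1..n}. V i \<noteq> {} \<longrightarrow> integer_box (2 * n) (V i)) \<and>
               realizes n (\<lambda>i. interior (V i)) C))
       \<and> ((\<exists>W :: nat \<Rightarrow> (real ^ 'd) set.
             (\<forall>i\<in>{1..n}. axis_box (W i)) \<and> realizes n (\<lambda>i. interior (W i)) C) \<longrightarrow>
          (\<exists>V :: nat \<Rightarrow> (real ^ 'd) set.
             (\<forall>i\<in>{1..n}. axis_box (V i)) \<and> realizes n V C))"
proof (intro conjI allI impI; elim conjE exE)
  fix U :: "nat \<Rightarrow> (real ^ 'd) set"
  assume "\<forall>i\<in>{1..n}. axis_box (U i)" and U: "realizes n U C"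
  then obtain V :: "nat \<Rightarrow> (real ^ 'd) set" where
    V: "\<And>i. V i = {} \<or> integer_box (2 * n) (V i)"
    and "code_of n V = code_of n U" "code_of n (\<lambda>i. interior (V i)) = code_of n U"
    using integer_realization by blast
  moreover have "axis_box (V i)" for i
    using V[of i] integer_box_imp_axis_box by (auto simp: axis_box_def)
  ultimately show "\<exists>V :: nat \<Rightarrow> (real ^ 'd) set. (\<forall>i\<in>{1..n}. axis_box (V i)) \<and> realizes n V C \<and>
      (\<forall>i\<in>{1..n}. V i \<noteq> {} \<longrightarrow> integer_box (2 * n) (V i)) \<and>
      realizes n (\<lambda>i. interior (V i)) C"
    using U unfolding realizes_def by (intro exI[of _ V]) auto
next
  fix W :: "nat \<Rightarrow> (real ^ 'd) set"
  assume "\<forall>i\<in>{1..n}. axis_box (W i)" and W: "realizes n (\<lambda>i. interior (W i)) C"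
  then obtain V :: "nat \<Rightarrow> (real ^ 'd) set" where
    "\<And>i. axis_box (V i)" "code_of n V = code_of n (\<lambda>i. interior (W i))"
    using closed_realization_of_interiors by blast
  with W show "\<exists>V :: nat \<Rightarrow> (real ^ 'd) set. (\<forall>i\<in>{1..n}. axis_box (V i)) \<and> realizes n V C"
    unfolding realizes_def by auto
qed

end
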